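(* Assume the tree matrix is transient. A function $h:I\to\mathbb R_+$ is harmonic and $\preceq$-increasing (i.e. $i\preceq j$ implies $h(i)\le h(j)$) if and only if there exists a finite (nonnegative) measure $\nu$ on $\partial_\infty$ such that $$h(i)=\int_{\partial_\infty}U_{i\xi}\,d\nu(\xi)\qquad\text{for every } i\in I.$$
   Context: Tree and matrix. $(I,\mathcal T)$ is a connected, locally finite, non-oriented tree with countably infinite set of sites $I$ and root $r$, every branch being infinite (each site has at least one successor). $|i|$ is the distance from $i$ to $r$; $i\preceq j$ means $i$ lies on the geodesic from $r$ to $j$; $i^-$ ($i\ne r$) is the neighbour of $i$ closer to $r$; $S_i=\{j:j^-=i\}$. $w:\mathbb N=\{0,1,\dots\}\to(0,\infty)$ is strictly increasing, $w_{-1}=0$. The tree matrix is $U_{ij}=w_{|i\wedge j|}$, with $i\wedge j$ the common vertex, farthest from $r$, of the geodesics from $r$ to $i$ and $j$. The matrix $Q$ is: $Q_{ii^-}=Q_{i^-i}=(w_{|i|}-w_{|i|-1})^{-1}$ for $i\neq r$, $Q_{ii}=-\big((w_{|i|}-w_{|i|-1})^{-1}+|S_i|(w_{|i|+1}-w_{|i|})^{-1}\big)$, and $0$ otherwise. A function $h:I\to\mathbb R$ is harmonic if $\sum_jQ_{ij}h(j)=0$ for all $i\in I$ (including $i=r$). Boundary. $\partial_\infty$ is the set of infinite geodesic rays $\xi=(\xi(n))_{n\ge0}$ with $\xi(0)=r$, $\xi(n+1)\in S_{\xi(n)}$, with the compact topology (and Borel $\sigma$-field) generated by the sets $\partial_\infty(i)=\{\xi:\xi(|i|)=i\}$,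 $i\in I$. $U_{i\xi}=w_{|i\wedge\xi|}$, where $|i\wedge\xi|$ is the largest level of a common vertex of the geodesic from $r$ to $i$ and the ray $\xi$. Transience. Let $X$ be the minimal continuous-time Markov chain on $I$ with $q$-matrix $Q$, absorbed from $r$ at rate $1/w_0$ in an extra state $\partial_r$. The tree matrix is transient if, started at $r$, the probability of never being absorbed at $\partial_r$ is positive. *)

theory Defs
  imports "HOL-Probability.Probability"
begin

text \<open>Trees. The set of sites is the whole type \<open>'i\<close>; \<open>E\<close> is the adjacency relation.\<close>

definition walk_between :: "('i \<Rightarrow> 'i \<Rightarrow> bool) \<Rightarrow> 'i \<Rightarrow> 'i \<Rightarrow> 'i list \<Rightarrow> bool" where
  "walk_between E i j p \<longleftrightarrow> p \<noteq> [] \<and> hd p = i \<and> last p = j \<and> successively E p"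

definition graph_cycle :: "('i \<Rightarrow> 'i \<Rightarrow> bool) \<Rightarrow> 'i list \<Rightarrow> bool" where
  "graph_cycle E p \<longleftrightarrow> length p \<ge> 3 \<and> distinct p \<and> successively E p \<and> E (last p) (hd p)"

definition graph_dist :: "('i \<Rightarrow> 'i \<Rightarrow> bool) \<Rightarrow> 'i \<Rightarrow> 'i \<Rightarrow> nat" where
  "graph_dist E i j = (LEAST n. \<exists>p. walk_between E i j p \<and> length p = Suc n)"

definition geodesic :: "('i \<Rightarrow> 'i \<Rightarrow> bool) \<Rightarrow> 'i \<Rightarrow> 'i \<Rightarrow> 'i list \<Rightarrow> bool" where
  "geodesic E i j p \<longleftrightarrow> walk_between E i j p \<and> length p = Suc (graph_dist E i j)"

definition level :: "('i \<Rightarrow> 'i \<Rightarrow> bool) \<Rightarrow> 'i \<Rightarrow> 'i \<Rightarrow> nat" where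
  "level E r i = graph_dist E i r"

definition tree_le :: "('i \<Rightarrow> 'i \<Rightarrow> bool) \<Rightarrow> 'i \<Rightarrow> 'i \<Rightarrow> 'i \<Rightarrow> bool" where
  "tree_le E r i j \<longleftrightarrow> (\<exists>p. geodesic E r j p \<and> i \<in> set p)"

text \<open>Only meaningful for \<open>i \<noteq> r\<close>.\<close>
definition parent :: "('i \<Rightarrow> 'i \<Rightarrow> bool) \<Rightarrow> 'i \<Rightarrow> 'i \<Rightarrow> 'i" where
  "parent E r i = (THE j. E i j \<and> level E r j < level E r i)"

definition successors :: "('i \<Rightarrow> 'i \<Rightarrow> bool) \<Rightarrow> 'i \<Rightarrow> 'i \<Rightarrow> 'i set" where
  "successors E r i = {j. j \<noteq> r \<and> parent E r j = i}"

locale infinite_rooted_tree =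
  fixes E :: "'i \<Rightarrow> 'i \<Rightarrow> bool" and r :: 'i
  assumes countable_sites: "countable (UNIV :: 'i set)"
    and infinite_sites: "infinite (UNIV :: 'i set)"
    and adj_sym: "E i j \<Longrightarrow> E j i"
    and adj_irrefl: "\<not> E i i"
    and connected: "\<exists>p. walk_between E i j p"
    and acyclic: "\<not> graph_cycle E p"
    and locally_finite: "finite {j. E i j}"
    and successors_nonempty: "successors E r i \<noteq> {}"

locale level_weights =
  fixes w :: "nat \<Rightarrow> real"
  assumes weight_pos: "0 < w n"
    and weight_strict_mono: "strict_mono w"

text \<open>\<open>w\<^sub>n - w\<^sub>n\<^sub>-\<^sub>1\<close>, with \<open>w\<^sub>-\<^sub>1 = 0\<close>.\<close>
definition weight_incr :: "(nat \<Rightarrow> real) \<Rightarrow> nat \<Rightarrow> real" where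
  "weight_incr w n = w n - (if n = 0 then 0 else w (n - 1))"

definition Q_matrix :: "('i \<Rightarrow> 'i \<Rightarrow> bool) \<Rightarrow> 'i \<Rightarrow> (nat \<Rightarrow> real) \<Rightarrow> 'i \<Rightarrow> 'i \<Rightarrow> real" where
  "Q_matrix E r w i j =
    (if i = j then
       - (1 / weight_incr w (level E r i)
          + real (card (successors E r i)) / weight_incr w (Suc (level E r i)))
     else if i \<noteq> r \<and> j = parent E r i then 1 / weight_incr w (level E r i)
     else if j \<noteq> r \<and> i = parent E r j then 1 / weight_incr w (level E r j)
     else 0)"

definition harmonic :: "('i \<Rightarrow> 'i \<Rightarrow> real) \<Rightarrow> ('i \<Rightarrow> real) \<Rightarrow> bool" where
  "harmonic Q h \<longleftrightarrow> (\<forall>i. ((\<lambda>j. Q i j * h j) has_sum 0) UNIV)"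

definition tree_increasing :: "('i \<Rightarrow> 'i \<Rightarrow> bool) \<Rightarrow> 'i \<Rightarrow> ('i \<Rightarrow> real) \<Rightarrow> bool" where
  "tree_increasing E r h \<longleftrightarrow> (\<forall>i j. tree_le E r i j \<longrightarrow> h i \<le> h j)"

definition boundary :: "('i \<Rightarrow> 'i \<Rightarrow> bool) \<Rightarrow> 'i \<Rightarrow> (nat \<Rightarrow> 'i) set" where
  "boundary E r = {\<xi>. \<xi> 0 = r \<and> (\<forall>n. \<xi> (Suc n) \<in> successors E r (\<xi> n))}"

definition boundary_cylinder :: "('i \<Rightarrow> 'i \<Rightarrow> bool) \<Rightarrow> 'i \<Rightarrow> 'i \<Rightarrow> (nat \<Rightarrow> 'i) set" where
  "boundary_cylinder E r i = {\<xi> \<in> boundary E r. \<xi> (level E r i) = i}"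

definition boundary_topology :: "('i \<Rightarrow> 'i \<Rightarrow> bool) \<Rightarrow> 'i \<Rightarrow> (nat \<Rightarrow> 'i) topology" where
  "boundary_topology E r = topology_generated_by (range (boundary_cylinder E r))"

definition boundary_borel :: "('i \<Rightarrow> 'i \<Rightarrow> bool) \<Rightarrow> 'i \<Rightarrow> (nat \<Rightarrow> 'i) measure" where
  "boundary_borel E r = sigma (boundary E r) {A. openin (boundary_topology E r) A}"

definition meet_level :: "('i \<Rightarrow> 'i \<Rightarrow> bool) \<Rightarrow> 'i \<Rightarrow> 'i \<Rightarrow> (nat \<Rightarrow> 'i) \<Rightarrow> nat" where
  "meet_level E r i \<xi> = Max {level E r k | k. tree_le E r k i \<and> k \<in> range \<xi>}"

definition U_boundary ::
  "('i \<Rightarrow> 'i \<Rightarrow> bool) \<Rightarrow> 'i \<Rightarrow> (nat \<Rightarrow> real) \<Rightarrow> 'i \<Rightarrow> (nat \<Rightarrow> 'i) \<Rightarrow> real" where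
  "U_boundary E r w i \<xi> = w (meet_level E r i \<xi>)"

text \<open>The minimal chain. \<open>Absorbed\<close> is the extra state \<open>\<partial>\<^sub>r\<close>; \<open>Exploded\<close> is the cemetery in which
  the minimal chain is put from its explosion time on (it is never a state of the jump chain).\<close>

datatype 'i state = Site 'i | Absorbed | Exploded

fun chain_rate ::
  "('i \<Rightarrow> 'i \<Rightarrow> bool) \<Rightarrow> 'i \<Rightarrow> (nat \<Rightarrow> real) \<Rightarrow> 'i state \<Rightarrow> 'i state \<Rightarrow> real" where
  "chain_rate E r w (Site i) (Site j) = Q_matrix E r w i j"
| "chain_rate E r w (Site i) Absorbed = (if i = r then 1 / w 0 else 0)"
| "chain_rate E r w (Site i) Exploded = 0"
| "chain_rate E r w Absorbed y = 0"
| "chain_rate E r w Exploded y = 0"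

definition exit_rate :: "('s \<Rightarrow> 's \<Rightarrow> real) \<Rightarrow> 's \<Rightarrow> real" where
  "exit_rate q x = - q x x"

definition jump_prob :: "('s \<Rightarrow> 's \<Rightarrow> real) \<Rightarrow> 's \<Rightarrow> 's \<Rightarrow> real" where
  "jump_prob q x y =
    (if exit_rate q x = 0 then (if y = x then 1 else 0)
     else if y = x then 0 else q x y / exit_rate q x)"

definition jump_pmf :: "('s \<Rightarrow> 's \<Rightarrow> real) \<Rightarrow> 's \<Rightarrow> 's pmf" where
  "jump_pmf q x = embed_pmf (jump_prob q x)"

definition holding_law :: "real \<Rightarrow> ennreal measure" where
  "holding_law c =
    (if c = 0 then return borel \<infinity>
     else distr (density lborel (\<lambda>t. ennreal (exponential_density c t))) borel ennreal)"

text \<open>Jump chain/holding time construction. A sample point consists of independent pairs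
  \<open>\<omega> (n, x)\<close>, one for each step \<open>n\<close> and state \<open>x\<close>: the state entered by the next jump and the
  time spent in \<open>x\<close> before, should the chain be in \<open>x\<close> after \<open>n\<close> jumps.\<close>

definition chain_space ::
  "('s \<Rightarrow> 's \<Rightarrow> real) \<Rightarrow> (nat \<times> 's \<Rightarrow> 's \<times> ennreal) measure" where
  "chain_space q =
    PiM UNIV (\<lambda>(n, x). measure_pmf (jump_pmf q x) \<Otimes>\<^sub>M holding_law (exit_rate q x))"

primrec jump_chain :: "'s \<Rightarrow> nat \<Rightarrow> (nat \<times> 's \<Rightarrow> 's \<times> ennreal) \<Rightarrow> 's" where
  "jump_chain x0 0 \<omega> = x0"
| "jump_chain x0 (Suc n) \<omega> = fst (\<omega> (n, jump_chain x0 n \<omega>))"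

definition jump_time :: "'s \<Rightarrow> nat \<Rightarrow> (nat \<times> 's \<Rightarrow> 's \<times> ennreal) \<Rightarrow> ennreal" where
  "jump_time x0 n \<omega> = (\<Sum>k<n. snd (\<omega> (k, jump_chain x0 k \<omega>)))"

definition minimal_chain ::
  "'i state \<Rightarrow> real \<Rightarrow> (nat \<times> 'i state \<Rightarrow> 'i state \<times> ennreal) \<Rightarrow> 'i state" where
  "minimal_chain x0 t \<omega> =
    (if \<exists>n. ennreal t < jump_time x0 (Suc n) \<omega>
     then jump_chain x0 (LEAST n. ennreal t < jump_time x0 (Suc n) \<omega>) \<omega>
     else Exploded)"

definition transient_tree_matrix ::
  "('i \<Rightarrow> 'i \<Rightarrow> bool) \<Rightarrow> 'i \<Rightarrow> (nat \<Rightarrow> real) \<Rightarrow> bool" where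
  "transient_tree_matrix E r w \<longleftrightarrow>
    measure (chain_space (chain_rate E r w))
      {\<omega> \<in> space (chain_space (chain_rate E r w)).
        \<forall>t\<ge>0. minimal_chain (Site r) t \<omega> \<noteq> Absorbed} > 0"

end

theory Submission
  imports Defs
begin

text \<open>Put \<open>m i = (h i - h i\<^sup>-) / (w\<^sub>n - w\<^sub>n\<^sub>-\<^sub>1)\<close> with \<open>n = |i|\<close>, and \<open>h i\<^sup>-\<close> read as \<open>0\<close> at the root.
  Harmonicity of \<open>h\<close> at \<open>i\<close> says that \<open>m i\<close> is the sum of \<open>m j\<close> over the successors \<open>j\<close> of \<open>i\<close>,
  monotonicity says \<open>m \<ge> 0\<close>, and, since \<open>U\<^sub>i\<^sub>\<xi>\<close> increases from \<open>i\<^sup>-\<close> to \<open>i\<close> by \<open>w\<^sub>n - w\<^sub>n\<^sub>-\<^sub>1\<close> exactly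
  on the cylinder of \<open>i\<close>, the integral representation says that \<open>\<nu>\<close> gives this cylinder mass \<open>m i\<close>.
  So the claim is that the consistent nonnegative functions \<open>m\<close> are those induced by finite
  measures on the boundary.\<close>

section \<open>Walks and graph distance\<close>

lemma walk_between_Cons: "E i j \<Longrightarrow> walk_between E j k p \<Longrightarrow> walk_between E i k (i # p)"
  by (auto simp: walk_between_def successively_Cons)

lemma walk_between_snoc: "walk_between E i j p \<Longrightarrow> E j k \<Longrightarrow> walk_between E i k (p @ [k])"
  by (auto simp: walk_between_def successively_append_iff)

lemma walk_between_rev:
  assumes "\<And>i j. E i j \<Longrightarrow> E j i" "walk_between E i j p"
  shows "walk_between E j i (rev p)"
proof -
  have "successively (\<lambda>x y. E y x) p"
    using assms by (auto simp: walk_between_def intro: successively_mono)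
  then show ?thesis
    using assms(2) by (auto simp: walk_between_def hd_rev last_rev)
qed

lemma graph_dist_le: "walk_between E i j p \<Longrightarrow> Suc (graph_dist E i j) \<le> length p"
proof -
  assume p: "walk_between E i j p"
  then have "length p = Suc (length p - 1)" by (cases p) (auto simp: walk_between_def)
  with p have "graph_dist E i j \<le> length p - 1"
    unfolding graph_dist_def by (intro Least_le) blast
  then show ?thesis using \<open>length p = _\<close> by linarith
qed

context infinite_rooted_tree
begin

abbreviation "lev \<equiv> level E r"
abbreviation "par \<equiv> parent E r"
abbreviation "succs \<equiv> successors E r"
abbreviation "cyl \<equiv> boundary_cylinder E r"

text \<open>Connectedness makes the set of walk lengths nonempty, so the minimum in
  \<open>graph_dist\<close> is attained.\<close>

lemma ex_shortest_walk: "\<exists>p. walk_between E i j p \<and> length p = Suc (graph_dist E i j)"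
proof -
  obtain p where p: "walk_between E i j p" using connected by blast
  then have "length p = Suc (length p - 1)" by (cases p) (auto simp: walk_between_def)
  with p have "\<exists>n p. walk_between E i j p \<and> length p = Suc n" by blast
  then show ?thesis unfolding graph_dist_def by (rule LeastI_ex)
qed

lemma graph_dist_commute: "graph_dist E i j = graph_dist E j i"
proof -
  have "graph_dist E i j \<le> graph_dist E j i" for i j
  proof -
    obtain p where "walk_between E j i p" "length p = Suc (graph_dist E j i)"
      using ex_shortest_walk by blast
    then show ?thesis
      using graph_dist_le[OF walk_between_rev, of E j i p] adj_sym by auto
  qed
  then show ?thesis by (simp add: antisym)
qed

section \<open>Levels and uniqueness of the parent\<close>

lemma level_eq_0_iff [simp]: "lev i = 0 \<longleftrightarrow> i = r"
proof
  assume "lev i = 0"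
  then obtain p where "walk_between E i r p" "length p = Suc 0"
    using ex_shortest_walk[of i r] by (auto simp: level_def)
  then show "i = r" by (cases p) (auto simp: walk_between_def)
next
  assume "i = r"
  then have "walk_between E i r [r]" by (simp add: walk_between_def)
  from graph_dist_le[OF this] show "lev i = 0" by (simp add: level_def)
qed

lemma level_root [simp]: "lev r = 0" by simp

lemma level_le_Suc_adj: "E i j \<Longrightarrow> lev i \<le> Suc (lev j)"
proof -
  assume ij: "E i j"
  obtain p where "walk_between E j r p" "length p = Suc (lev j)"
    using ex_shortest_walk by (auto simp: level_def)
  then show ?thesis
    using graph_dist_le[OF walk_between_Cons, of E i j r p] ij by (auto simp: level_def)
qed

text \<open>The second site of a shortest walk to the root is one step closer to it.\<close>

lemma ex_lower_neighbour:
  assumes "i \<noteq> r"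
  shows "\<exists>j. E i j \<and> Suc (lev j) = lev i"
proof -
  obtain p where p: "walk_between E i r p" "length p = Suc (lev i)"
    using ex_shortest_walk by (auto simp: level_def)
  obtain a q where "p = a # q" using p(2) by (cases p) auto
  with p assms obtain j q' where q: "p = i # j # q'"
    by (cases q) (auto simp: walk_between_def)
  with p have "E i j" and "walk_between E j r (j # q')"
    by (auto simp: walk_between_def)
  with p(2) q have "E i j" "Suc (lev j) \<le> lev i"
    using graph_dist_le[of E j r "j # q'"] by (auto simp: level_def)
  with level_le_Suc_adj[of i j] show ?thesis by force
qed

text \<open>Descend from both sites in parallel until the two descents meet. The bound on the levels
  serves to close the path into a cycle: a site above level \<open>n\<close> adjacent to both ends
  is not on the path, and length at least 2 then gives the three sites that
  \<open>graph_cycle\<close> requires.\<close>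

lemma ex_path_below_level:
  assumes "a \<noteq> b" "lev a = n" "lev b = n"
  shows "\<exists>p. walk_between E a b p \<and> distinct p \<and> 2 \<le> length p \<and> (\<forall>k\<in>set p. lev k \<le> n)"
  using assms
proof (induction n arbitrary: a b)
  case 0
  then show ?case by simp
next
  case (Suc n)
  from Suc.prems have "a \<noteq> r" "b \<noteq> r" using level_root by (metis nat.distinct(1))+
  then obtain a' b' where ab: "E a a'" "lev a' = n" "E b b'" "lev b' = n"
    using ex_lower_neighbour Suc.prems by (metis Suc_inject)
  show ?case
  proof (cases "a' = b'")
    case True
    have "walk_between E a b [a, a', b]"
      using ab True adj_sym by (auto simp: walk_between_def)
    moreover have "a \<noteq> a'" "a' \<noteq> b" using Suc.prems ab(2) by (metis n_not_Suc_n)+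
    ultimately show ?thesis using Suc.prems ab(2) by (intro exI[of _ "[a, a', b]"]) simp
  next
    case False
    from Suc.IH[OF this] ab obtain p
      where p: "walk_between E a' b' p" "distinct p" "\<forall>k\<in>set p. lev k \<le> n" by blast
    have "walk_between E a b (a # (p @ [b]))"
      using p(1) ab adj_sym by (intro walk_between_Cons walk_between_snoc) auto
    moreover have "a \<notin> set p" "b \<notin> set p" using p(3) Suc.prems by fastforce+
    ultimately show ?thesis using p Suc.prems
      by (intro exI[of _ "a # (p @ [b])"]) (auto simp: walk_between_def)
  qed
qed

lemma lower_neighbour_unique:
  assumes "E i a" "lev a < lev i" "E i b" "lev b < lev i"
  shows "a = b"
proof (rule ccontr)
  assume "a \<noteq> b"
  moreover have "lev a = lev i - 1" "lev b = lev i - 1"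
    using assms level_le_Suc_adj[of i a] level_le_Suc_adj[of i b] by auto
  ultimately obtain p where p: "walk_between E a b p" "distinct p" "2 \<le> length p"
      "\<forall>k\<in>set p. lev k \<le> lev i - 1"
    using ex_path_below_level by blast
  then have "i \<notin> set p" using assms by fastforce
  with p assms have "graph_cycle E (i # p)"
    using adj_sym by (auto simp: graph_cycle_def walk_between_def successively_Cons)
  with acyclic show False by blast
qed

lemma parent_unique: "E i j \<Longrightarrow> lev j < lev i \<Longrightarrow> par i = j"
  unfolding parent_def by (rule the_equality) (auto intro: lower_neighbour_unique)

lemma
  assumes "i \<noteq> r"
  shows parent_adj: "E i (par i)" and Suc_level_parent [simp]: "Suc (lev (par i)) = lev i"
proof -
  obtain j where j: "E i j" "Suc (lev j) = lev i" using ex_lower_neighbour[OF assms] by blast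
  with parent_unique[of i j] show "E i (par i)" "Suc (lev (par i)) = lev i" by auto
qed

section \<open>Successors, geodesics and the tree order\<close>

lemma successorsD: "j \<in> succs i \<Longrightarrow> j \<noteq> r \<and> par j = i \<and> lev j = Suc (lev i)"
  using Suc_level_parent[of j] by (auto simp: successors_def)

lemma successors_parent: "i \<noteq> r \<Longrightarrow> i \<in> succs (par i)"
  by (simp add: successors_def)

lemma finite_successors [simp]: "finite (succs i)"
  by (rule finite_subset[OF _ locally_finite[of i]])
    (auto simp: successors_def intro: adj_sym parent_adj)

text \<open>The last but one site of a geodesic from the root has a smaller level than the end, so
  it must be the parent. This yields the recursion \<open>tree_le_rec\<close>, through which the
  order is handled from then on.\<close>

lemma geodesic_snoc_iff:
  assumes "i \<noteq> r"
  shows "geodesic E r i p \<longleftrightarrow> (\<exists>q. p = q @ [i] \<and> geodesic E r (par i) q)"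
proof
  assume p: "geodesic E r i p"
  then have l: "length p = Suc (lev i)" and w: "walk_between E r i p"
    by (auto simp: geodesic_def level_def graph_dist_commute)
  from w obtain q where q: "p = q @ [i]"
    by (metis walk_between_def append_butlast_last_id)
  with w assms have "q \<noteq> []" by (auto simp: walk_between_def)
  with w q have wq: "walk_between E r (last q) q" and e: "E (last q) i"
    by (auto simp: walk_between_def successively_append_iff)
  from graph_dist_le[OF wq] q l have "lev (last q) < lev i"
    by (auto simp: level_def graph_dist_commute)
  with parent_unique[OF adj_sym[OF e]] have "par i = last q" by blast
  moreover have "length q = Suc (lev (par i))" using q l assms by simp
  ultimately show "\<exists>q. p = q @ [i] \<and> geodesic E r (par i) q"
    using q wq by (auto simp: geodesic_def level_def graph_dist_commute)
next
  assume "\<exists>q. p = q @ [i] \<and> geodesic E r (par i) q"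
  then obtain q where q: "p = q @ [i]" "geodesic E r (par i) q" by blast
  then show "geodesic E r i p"
    using walk_between_snoc[of E r "par i" q i] adj_sym[OF parent_adj[OF assms]]
      Suc_level_parent[OF assms]
    by (auto simp: geodesic_def level_def graph_dist_commute)
qed

lemma ex_geodesic: "\<exists>p. geodesic E r i p"
  using ex_shortest_walk by (simp add: geodesic_def)

lemma geodesic_root_iff: "geodesic E r r p \<longleftrightarrow> p = [r]"
proof -
  have "graph_dist E r r = 0" using level_root by (simp add: level_def)
  then show ?thesis by (cases p) (auto simp: geodesic_def walk_between_def)
qed

lemma tree_le_rec: "tree_le E r k i \<longleftrightarrow> k = i \<or> (i \<noteq> r \<and> tree_le E r k (par i))"
proof (cases "i = r")
  case True
  then show ?thesis by (auto simp: tree_le_def geodesic_root_iff)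
next
  case False
  then show ?thesis using ex_geodesic[of "par i"]
    by (fastforce simp: tree_le_def geodesic_snoc_iff)
qed

lemma tree_induct [case_names root child]:
  assumes "P r" "\<And>i. i \<noteq> r \<Longrightarrow> P (par i) \<Longrightarrow> P i"
  shows "P i"
proof (induction "lev i" arbitrary: i)
  case 0
  then show ?case using assms(1) by auto
next
  case (Suc n)
  then have "i \<noteq> r" by auto
  moreover from this have "lev (par i) = n"
    using Suc.hyps(2) Suc_level_parent[of i] by linarith
  ultimately show ?case using Suc.hyps(1) assms(2) by auto
qed

lemma tree_le_level: "tree_le E r k i \<Longrightarrow> lev k \<le> lev i"
proof (induction i rule: tree_induct)
  case root
  then show ?case by (subst (asm) tree_le_rec) simp
next
  case (child i)
  have "lev (par i) \<le> lev i" using Suc_level_parent[OF child.hyps] by linarith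
  with child show ?case by (subst (asm) tree_le_rec) auto
qed

text \<open>Ensures that the \<open>Max\<close> in \<open>meet_level\<close> is taken over a finite
  set.\<close>

lemma finite_tree_le: "finite {k. tree_le E r k i}"
proof (induction i rule: tree_induct)
  case root
  then show ?case by (subst tree_le_rec) simp
next
  case (child i)
  then show ?case by (subst tree_le_rec) simp
qed

lemma tree_increasing_iff: "tree_increasing E r h \<longleftrightarrow> (\<forall>i. i \<noteq> r \<longrightarrow> h (par i) \<le> h i)"
proof
  assume h: "tree_increasing E r h"
  show "\<forall>i. i \<noteq> r \<longrightarrow> h (par i) \<le> h i"
  proof safe
    fix i assume "i \<noteq> r"
    then have "tree_le E r (par i) i"
      by (subst tree_le_rec, subst tree_le_rec) simp
    with h show "h (par i) \<le> h i" by (simp add: tree_increasing_def)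
  qed
next
  assume h: "\<forall>i. i \<noteq> r \<longrightarrow> h (par i) \<le> h i"
  have "tree_le E r k i \<Longrightarrow> h k \<le> h i" for k i
  proof (induction i rule: tree_induct)
    case root
    then show ?case by (subst (asm) tree_le_rec) simp
  next
    case (child i)
    then show ?case using h by (subst (asm) tree_le_rec) force
  qed
  then show "tree_increasing E r h" by (simp add: tree_increasing_def)
qed

section \<open>Rays, cylinders and the boundary kernel\<close>

lemma ray_root: "\<xi> \<in> boundary E r \<Longrightarrow> \<xi> 0 = r"
  and ray_successor: "\<xi> \<in> boundary E r \<Longrightarrow> \<xi> (Suc n) \<in> succs (\<xi> n)"
  by (auto simp: boundary_def)

lemma level_ray: "\<xi> \<in> boundary E r \<Longrightarrow> lev (\<xi> n) = n"
proof (induction n)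
  case (Suc n)
  then show ?case using successorsD[OF ray_successor[OF Suc.prems, of n]] by simp
qed (simp add: ray_root)

lemma parent_ray: "\<xi> \<in> boundary E r \<Longrightarrow> par (\<xi> (Suc n)) = \<xi> n"
  using successorsD[OF ray_successor] by simp

text \<open>A ray is at level \<open>n\<close> at time \<open>n\<close>, so the only time at which
  it can visit \<open>i\<close> is \<open>lev i\<close>.\<close>

lemma in_cylinder_iff: "\<xi> \<in> cyl i \<longleftrightarrow> \<xi> \<in> boundary E r \<and> i \<in> range \<xi>"
  using level_ray[of \<xi>] by (auto simp: boundary_cylinder_def) (metis rangeI)

lemma cylinder_root [simp]: "cyl r = boundary E r"
  by (auto simp: boundary_cylinder_def boundary_def)

lemma cylinder_parent: "i \<noteq> r \<Longrightarrow> cyl i \<subseteq> cyl (par i)"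
proof
  fix \<xi> assume i: "i \<noteq> r" and "\<xi> \<in> cyl i"
  then have b: "\<xi> \<in> boundary E r" and "\<xi> (Suc (lev (par i))) = i"
    by (auto simp: boundary_cylinder_def)
  with parent_ray[OF b, of "lev (par i)"] show "\<xi> \<in> cyl (par i)"
    by (auto simp: boundary_cylinder_def)
qed

lemma cylinder_successor_iff:
  "j \<in> succs i \<Longrightarrow> \<xi> \<in> cyl j \<longleftrightarrow> \<xi> \<in> boundary E r \<and> \<xi> (Suc (lev i)) = j"
  by (auto simp: boundary_cylinder_def dest!: successorsD)

lemma cylinder_eq_Union_successors: "cyl i = (\<Union>j\<in>succs i. cyl j)"
proof
  show "cyl i \<subseteq> (\<Union>j\<in>succs i. cyl j)"
    by (auto simp: boundary_cylinder_def boundary_def) (metis successorsD)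
  show "(\<Union>j\<in>succs i. cyl j) \<subseteq> cyl i"
    using cylinder_parent successorsD by blast
qed

lemma disjoint_family_cylinder_successors: "disjoint_family_on cyl (succs i)"
  by (auto simp: disjoint_family_on_def cylinder_successor_iff)

lemma meet_level_in: "\<xi> \<in> cyl i \<Longrightarrow> meet_level E r i \<xi> = lev i"
proof -
  assume x: "\<xi> \<in> cyl i"
  have fin: "finite {lev k | k. tree_le E r k i \<and> k \<in> range \<xi>}"
    by (rule finite_subset[OF _ finite_imageI[OF finite_tree_le[of i], of lev]]) auto
  have "tree_le E r i i" by (subst tree_le_rec) simp
  with x fin show ?thesis unfolding meet_level_def
    by (intro Max_eqI) (auto simp: in_cylinder_iff dest: tree_le_level)
qed

lemma meet_level_notin:
  assumes "\<xi> \<in> boundary E r" "\<xi> \<notin> cyl i"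
  shows "meet_level E r i \<xi> = meet_level E r (par i) \<xi>"
proof -
  \<comment> \<open>The root lies on every ray, so a site missed by the ray has a parent, and
    dropping the site itself loses no common vertex.\<close>
  have "i \<noteq> r" and "i \<notin> range \<xi>" using assms in_cylinder_iff[of \<xi> i] cylinder_root by blast+
  then have "tree_le E r k i \<and> k \<in> range \<xi> \<longleftrightarrow> tree_le E r k (par i) \<and> k \<in> range \<xi>" for k
    by (subst tree_le_rec) auto
  then show ?thesis unfolding meet_level_def by simp
qed

lemma U_boundary_root: "\<xi> \<in> boundary E r \<Longrightarrow> U_boundary E r w r \<xi> = w 0"
  by (simp add: U_boundary_def meet_level_in)

text \<open>On the cylinder of \<open>i\<close> the meet levels of \<open>i\<close> and
  \<open>par i\<close> are \<open>lev i\<close> and \<open>lev i - 1\<close>; off it they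
  coincide.\<close>

lemma U_boundary_rec:
  assumes "\<xi> \<in> boundary E r" "i \<noteq> r"
  shows "U_boundary E r w i \<xi> =
    U_boundary E r w (par i) \<xi> + weight_incr w (lev i) * indicator (cyl i) \<xi>"
proof (cases "\<xi> \<in> cyl i")
  case True
  with cylinder_parent[OF assms(2)] have "\<xi> \<in> cyl (par i)" by auto
  moreover have "lev (par i) = lev i - Suc 0" using Suc_level_parent[OF assms(2)] by linarith
  ultimately show ?thesis using True assms(2)
    by (simp add: U_boundary_def meet_level_in weight_incr_def)
next
  case False
  then show ?thesis using assms by (simp add: U_boundary_def meet_level_notin)
qed

section \<open>Topology and Borel sets of the boundary\<close>

lemma openin_boundary_cylinder:
  assumes "openin (boundary_topology E r) A" "\<xi> \<in> A"
  shows "\<exists>i. \<xi> \<in> cyl i \<and> cyl i \<subseteq> A"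
proof -
  \<comment> \<open>Cylinders shrink along a ray, so the deeper of two sites on a common ray has its
    cylinder inside both. Hence the generating sets form a base, not merely a subbase.\<close>
  have mono: "cyl (\<xi> n) \<subseteq> cyl (\<xi> m)" if "m \<le> n" "\<xi> \<in> boundary E r" for \<xi> m n
    using that(1)
  proof (induction rule: dec_induct)
    case (step n)
    have "\<xi> (Suc n) \<noteq> r" using that(2) successorsD by (auto simp: boundary_def)
    from cylinder_parent[OF this] parent_ray[OF that(2)] step show ?case by auto
  qed simp
  have "generate_topology_on (range cyl) A"
    using assms(1) by (simp add: boundary_topology_def openin_topology_generated_by_iff)
  then show ?thesis using assms(2)
  proof (induction arbitrary: \<xi>)
    case (Int a b)
    then obtain i j where ij: "\<xi> \<in> cyl i" "cyl i \<subseteq> a" "\<xi> \<in> cyl j" "cyl j \<subseteq> b" by blast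
    then have b: "\<xi> \<in> boundary E r" and e: "\<xi> (lev i) = i" "\<xi> (lev j) = j"
      by (auto simp: boundary_cylinder_def)
    define n where "n = max (lev i) (lev j)"
    have "cyl (\<xi> n) \<subseteq> cyl i \<inter> cyl j"
      using mono[OF _ b, of "lev i" n] mono[OF _ b, of "lev j" n] e by (auto simp: n_def)
    moreover have "\<xi> \<in> cyl (\<xi> n)" using b by (auto simp: in_cylinder_iff)
    ultimately show ?case using ij by blast
  next
    case (UN K)
    then show ?case by (meson UnionE Union_upper order_trans)
  qed auto
qed

text \<open>Open sets are unions of cylinders, and these unions are countable because there are
  countably many sites. So measurability of a map into the boundary can be tested on
  cylinders.\<close>

lemma space_boundary_borel: "space (boundary_borel E r) = boundary E r"
  and sets_boundary_borel: "sets (boundary_borel E r) = sigma_sets (boundary E r) (range cyl)"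
proof -
  have sub: "{A. openin (boundary_topology E r) A} \<subseteq> Pow (boundary E r)"
  proof
    fix A assume "A \<in> {A. openin (boundary_topology E r) A}"
    then have "A \<subseteq> topspace (boundary_topology E r)" by (simp add: openin_subset)
    also have "\<dots> \<subseteq> boundary E r"
      by (auto simp: boundary_topology_def topology_generated_by_topspace boundary_cylinder_def)
    finally show "A \<in> Pow (boundary E r)" by simp
  qed
  then show "space (boundary_borel E r) = boundary E r"
    by (simp add: boundary_borel_def)
  have "sigma_sets (boundary E r) {A. openin (boundary_topology E r) A}
      = sigma_sets (boundary E r) (range cyl)"
  proof (rule sigma_sets_eqI)
    fix A assume "A \<in> {A. openin (boundary_topology E r) A}"
    then have "A = (\<Union>i\<in>{i. cyl i \<subseteq> A}. cyl i)"
      using openin_boundary_cylinder[of A] by auto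
    moreover have "(\<Union>i\<in>{i. cyl i \<subseteq> A}. cyl i) \<in> sigma_sets (boundary E r) (range cyl)"
      by (rule sigma_sets_UNION)
        (auto intro: countable_subset[OF subset_UNIV countable_sites] sigma_sets.Basic)
    ultimately show "A \<in> sigma_sets (boundary E r) (range cyl)" by simp
  next
    fix A assume "A \<in> range cyl"
    then have "openin (boundary_topology E r) A"
      by (auto simp: boundary_topology_def openin_topology_generated_by_iff
          intro: generate_topology_on.Basis)
    then show "A \<in> sigma_sets (boundary E r) {A. openin (boundary_topology E r) A}"
      by (auto intro: sigma_sets.Basic)
  qed
  with sub show "sets (boundary_borel E r) = sigma_sets (boundary E r) (range cyl)"
    by (simp add: boundary_borel_def)
qed

lemma cylinder_in_sets: "cyl i \<in> sets (boundary_borel E r)"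
  by (auto simp: sets_boundary_borel intro: sigma_sets.Basic)

section \<open>From consistent cylinder masses to a measure\<close>

primrec ray_of :: "('i \<Rightarrow> 'i) \<Rightarrow> nat \<Rightarrow> 'i" where
  "ray_of f 0 = r"
| "ray_of f (Suc n) = f (ray_of f n)"

lemma ray_of_in_boundary: "(\<And>i. f i \<in> succs i) \<Longrightarrow> ray_of f \<in> boundary E r"
  by (simp add: boundary_def)

text \<open>A consistent mass function on the cylinders is the law of the ray that leaves each site \<open>i\<close>
  through a successor chosen independently with probability proportional to the masses; if \<open>m i = 0\<close>
  the choice is irrelevant and uniform.\<close>

lemma ex_measure_on_boundary:
  fixes m :: "'i \<Rightarrow> real"
  assumes nonneg: "\<And>i. 0 \<le> m i" and additive: "\<And>i. m i = (\<Sum>j\<in>succs i. m j)"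
  shows "\<exists>\<nu>. finite_measure \<nu> \<and> sets \<nu> = sets (boundary_borel E r) \<and>
    (\<forall>i. measure \<nu> (cyl i) = m i)"
proof -
  define p where "p i j = (if m i = 0 then 1 / real (card (succs i)) else m j / m i)" for i j
  define M where "M i = point_measure (succs i) (\<lambda>j. ennreal (p i j))" for i
  define N where "N = PiM UNIV M"
  have p_nonneg: "0 \<le> p i j" for i j using nonneg by (simp add: p_def)
  have p_sum: "(\<Sum>j\<in>succs i. p i j) = 1" for i
  proof (cases "m i = 0")
    case True
    then show ?thesis using successors_nonempty[of i] by (simp add: p_def)
  next
    case False
    then have "(\<Sum>j\<in>succs i. p i j) = (\<Sum>j\<in>succs i. m j) / m i"
      by (simp add: p_def sum_divide_distrib)
    with additive[of i] False show ?thesis by simp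
  qed
  \<comment> \<open>If \<open>m i = 0\<close>, additivity and nonnegativity force
    \<open>m j = 0\<close>, so the identity survives the arbitrary default in
    \<open>p\<close>.\<close>
  have m_p: "m i * p i j = m j" if "j \<in> succs i" for i j
  proof (cases "m i = 0")
    case True
    with additive[of i] that nonneg have "m j = 0"
      by (simp add: sum_nonneg_eq_0_iff)
    with True show ?thesis by simp
  qed (simp add: p_def)
  have space_M: "space (M i) = succs i" and sets_M: "sets (M i) = Pow (succs i)" for i
    by (simp_all add: M_def space_point_measure sets_point_measure)
  have prob_M: "prob_space (M i)" for i
  proof
    show "emeasure (M i) (space (M i)) = 1"
      unfolding space_M unfolding M_def
      by (subst emeasure_point_measure_finite) (auto simp: p_nonneg sum_ennreal p_sum)
  qed
  have emeasure_M: "emeasure (M i) {j} = ennreal (p i j)" if "j \<in> succs i" for i j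
    unfolding M_def using that by (subst emeasure_point_measure_finite) auto
  interpret M: product_prob_space M UNIV
    by (rule product_prob_spaceI) (rule prob_M)
  interpret N: prob_space N unfolding N_def by (rule M.prob_space_axioms)
  have space_N: "space N = {f. \<forall>i. f i \<in> succs i}"
    by (auto simp: N_def space_PiM space_M PiE_def Pi_def)

  let ?ev = "\<lambda>i. {f \<in> space N. ray_of f (lev i) = i}"
  \<comment> \<open>Reaching \<open>i\<close> constrains the choices only at the sites strictly
    before \<open>i\<close>, and these are finitely many coordinates of the product. The bound
    \<open>lev k < lev i\<close> is carried along so that \<open>par i\<close> is a fresh coordinate
    in the next step, contributing exactly one factor \<open>p (par i) i\<close>. The factor
    \<open>m r\<close> makes the product telescope to \<open>m i\<close>.\<close>
  have cylinder_event: "\<exists>J F. finite J \<and> (\<forall>k\<in>J. lev k < lev i \<and> F k \<in> sets (M k)) \<and>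
      ?ev i = prod_emb UNIV M J (Pi\<^sub>E J F) \<and>
      ennreal (m r) * (\<Prod>k\<in>J. emeasure (M k) (F k)) = ennreal (m i)" for i
  proof (induction i rule: tree_induct)
    case root
    show ?case
      by (rule exI[of _ "{}"]) (auto simp: N_def space_PiM prod_emb_def)
  next
    case (child i)
    from child.IH obtain J F where J: "finite J" "\<forall>k\<in>J. lev k < lev (par i) \<and> F k \<in> sets (M k)"
      "?ev (par i) = prod_emb UNIV M J (Pi\<^sub>E J F)"
      "ennreal (m r) * (\<Prod>k\<in>J. emeasure (M k) (F k)) = ennreal (m (par i))" by blast
    let ?F = "F(par i := {i})"
    have notin: "par i \<notin> J" using J(2) by auto
    then have F_eq: "?F k = F k" if "k \<in> J" for k using that by auto
    have i: "i \<in> succs (par i)" using child.hyps by (rule successors_parent)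
    have lev_i: "lev i = Suc (lev (par i))" using child.hyps by simp
    have "?ev i = ?ev (par i) \<inter> {f. f (par i) = i}"
    proof -
      \<comment> \<open>If the ray is at \<open>i\<close> after its next step, the site before it is
        the parent of \<open>i\<close>, so the choice that led to \<open>i\<close> was made at
        \<open>par i\<close>.\<close>
      have "ray_of f (lev (par i)) = par i \<and> f (par i) = i"
        if "f \<in> space N" "f (ray_of f (lev (par i))) = i" for f
        using parent_ray[OF ray_of_in_boundary, of f "lev (par i)"] that by (auto simp: space_N)
      then show ?thesis unfolding lev_i by auto
    qed
    also have "\<dots> = prod_emb UNIV M (insert (par i) J) (Pi\<^sub>E (insert (par i) J) ?F)"
      unfolding J(3) by (auto simp: prod_emb_def PiE_iff F_eq fun_upd_same simp del: fun_upd_apply)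
    finally have ev: "?ev i = prod_emb UNIV M (insert (par i) J) (Pi\<^sub>E (insert (par i) J) ?F)" .
    have "(\<Prod>k\<in>insert (par i) J. emeasure (M k) (?F k))
        = ennreal (p (par i) i) * (\<Prod>k\<in>J. emeasure (M k) (F k))"
    proof -
      have "(\<Prod>k\<in>J. emeasure (M k) (?F k)) = (\<Prod>k\<in>J. emeasure (M k) (F k))"
        using F_eq by (intro prod.cong) auto
      then show ?thesis using notin J(1) emeasure_M[OF i] by simp
    qed
    then have "ennreal (m r) * (\<Prod>k\<in>insert (par i) J. emeasure (M k) (?F k))
        = ennreal (m (par i)) * ennreal (p (par i) i)"
      unfolding J(4)[symmetric] by (simp only: ac_simps)
    also have "\<dots> = ennreal (m i)"
      using m_p[OF i] by (simp add: nonneg p_nonneg flip: ennreal_mult)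
    finally have prod: "ennreal (m r) * (\<Prod>k\<in>insert (par i) J. emeasure (M k) (?F k)) = ennreal (m i)" .
    have "\<forall>k\<in>insert (par i) J. lev k < lev i \<and> ?F k \<in> sets (M k)"
      unfolding lev_i using J(2) i by (auto simp: sets_M less_SucI)
    with J(1) ev prod show ?case by (intro exI[of _ "insert (par i) J"] exI[of _ ?F]) blast
  qed
  have ev_sets: "?ev i \<in> sets N"
    and ev_emeasure: "ennreal (m r) * emeasure N (?ev i) = ennreal (m i)" for i
  proof -
    obtain J F where J: "finite J" "\<forall>k\<in>J. F k \<in> sets (M k)"
      "?ev i = prod_emb UNIV M J (Pi\<^sub>E J F)"
      "ennreal (m r) * (\<Prod>k\<in>J. emeasure (M k) (F k)) = ennreal (m i)"
      using cylinder_event[of i] by blast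
    show "?ev i \<in> sets N" unfolding J(3) unfolding N_def using J(1,2) by (intro sets_PiM_I) auto
    show "ennreal (m r) * emeasure N (?ev i) = ennreal (m i)"
      unfolding J(3) unfolding N_def using J(1,2,4) by (subst M.emeasure_PiM_emb) auto
  qed
  have vimage_ray: "ray_of -` cyl i \<inter> space N = ?ev i" for i
    using ray_of_in_boundary by (auto simp: boundary_cylinder_def space_N)
  have ray: "ray_of \<in> measurable N (boundary_borel E r)"
  proof (rule measurable_sigma_sets[OF sets_boundary_borel])
    show "range cyl \<subseteq> Pow (boundary E r)" by (auto simp: boundary_cylinder_def)
    show "ray_of \<in> space N \<rightarrow> boundary E r" using ray_of_in_boundary by (auto simp: space_N)
  qed (auto simp: vimage_ray ev_sets)
  \<comment> \<open>The law of the random ray is a probability; scaling gives it total mass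
    \<open>m r\<close>, and the zero measure when \<open>m r = 0\<close>.\<close>
  define \<nu> where "\<nu> = scale_measure (ennreal (m r)) (distr N (boundary_borel E r) ray_of)"
  have em: "emeasure \<nu> (cyl i) = ennreal (m i)" for i
    by (simp add: \<nu>_def emeasure_distr[OF ray cylinder_in_sets] vimage_ray ev_emeasure)
  have sets_\<nu>: "sets \<nu> = sets (boundary_borel E r)" by (simp add: \<nu>_def)
  moreover have "space \<nu> = cyl r"
    using sets_eq_imp_space_eq[OF sets_\<nu>] by (simp add: space_boundary_borel)
  then have "finite_measure \<nu>"
    using em[of r] by (intro finite_measureI) simp
  moreover have "measure \<nu> (cyl i) = m i" for i
    by (simp add: measure_def em nonneg)
  ultimately show ?thesis by blast
qed

section \<open>Harmonicity and integrals in terms of cylinder masses\<close>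

definition cylinder_mass :: "(nat \<Rightarrow> real) \<Rightarrow> ('i \<Rightarrow> real) \<Rightarrow> 'i \<Rightarrow> real" where
  "cylinder_mass w h i = (h i - (if i = r then 0 else h (par i))) / weight_incr w (lev i)"

text \<open>Row \<open>i\<close> of \<open>Q\<close> splits into difference quotients of
  \<open>h\<close> along the edges at \<open>i\<close>: those to the successors enter with a plus
  sign, the one from the parent with a minus sign. At the root the latter becomes
  \<open>h r / w 0\<close>, the loss through absorption, as if \<open>h\<close> vanished at the
  extra state.\<close>

lemma Q_matrix_sum:
  "((\<lambda>j. Q_matrix E r w i j * h j) has_sum
     ((\<Sum>j\<in>succs i. cylinder_mass w h j) - cylinder_mass w h i)) UNIV"
proof -
  let ?f = "\<lambda>j. Q_matrix E r w i j * h j"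
  let ?P = "if i = r then {} else {par i}"
  \<comment> \<open>Levels separate \<open>i\<close>, its parent and its successors, so the nested
    cases of \<open>Q_matrix\<close> do not shadow one another and the finite sum splits.\<close>
  have "i \<notin> succs i" using successorsD[of i i] by auto
  moreover have "par i \<noteq> i" "par i \<notin> succs i" if "i \<noteq> r"
    using that successorsD[of "par i" i] Suc_level_parent[of i] by fastforce+
  note par = this
  ultimately have disj: "i \<notin> succs i" "?P \<inter> insert i (succs i) = {}" by auto
  have zero: "?f j = 0" if "j \<notin> ?P \<union> insert i (succs i)" for j
    using that by (auto simp: Q_matrix_def successors_def split: if_splits)
  have has_sum: "(?f has_sum (sum ?f (?P \<union> insert i (succs i)))) UNIV"
    using zero by (intro has_sum_finite_neutralI) auto
  have split: "sum ?f (?P \<union> insert i (succs i)) = sum ?f ?P + ?f i + sum ?f (succs i)"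
    using disj by (subst sum.union_disjoint) auto
  have pred: "sum ?f ?P = (if i = r then 0 else h (par i)) / weight_incr w (lev i)"
    using par(1) by (auto simp: Q_matrix_def)
  have succ: "sum ?f (succs i) = (\<Sum>j\<in>succs i. h j / weight_incr w (Suc (lev i)))"
  proof (rule sum.cong)
    fix j assume "j \<in> succs i"
    then have "j \<noteq> i" "\<not> (i \<noteq> r \<and> j = par i)" using disj(1) par(2) by auto
    with successorsD[OF \<open>j \<in> succs i\<close>] show "?f j = h j / weight_incr w (Suc (lev i))" by (simp add: Q_matrix_def) blast
  qed simp
  have mass: "(\<Sum>j\<in>succs i. cylinder_mass w h j)
      = (\<Sum>j\<in>succs i. h j / weight_incr w (Suc (lev i)))
        - real (card (succs i)) * h i / weight_incr w (Suc (lev i))"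
  proof -
    have "(\<Sum>j\<in>succs i. cylinder_mass w h j)
        = (\<Sum>j\<in>succs i. h j / weight_incr w (Suc (lev i)) - h i / weight_incr w (Suc (lev i)))"
      by (intro sum.cong) (auto simp: cylinder_mass_def diff_divide_distrib dest!: successorsD)
    then show ?thesis by (simp add: sum_subtractf)
  qed
  have diag: "?f i = - h i / weight_incr w (lev i)
      - real (card (succs i)) * h i / weight_incr w (Suc (lev i))"
    by (simp add: Q_matrix_def algebra_simps)
  have "sum ?f (?P \<union> insert i (succs i))
      = (\<Sum>j\<in>succs i. cylinder_mass w h j) - cylinder_mass w h i"
    unfolding split pred succ mass diag by (simp add: cylinder_mass_def diff_divide_distrib)
  with has_sum show ?thesis by simp
qed

lemma harmonic_iff:
  "harmonic (Q_matrix E r w) h \<longleftrightarrow>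
    (\<forall>i. cylinder_mass w h i = (\<Sum>j\<in>succs i. cylinder_mass w h j))"
proof -
  have "((\<lambda>j. Q_matrix E r w i j * h j) has_sum 0) UNIV \<longleftrightarrow>
      cylinder_mass w h i = (\<Sum>j\<in>succs i. cylinder_mass w h j)" for i
  proof
    assume "((\<lambda>j. Q_matrix E r w i j * h j) has_sum 0) UNIV"
    from has_sum_unique[OF Q_matrix_sum this]
    show "cylinder_mass w h i = (\<Sum>j\<in>succs i. cylinder_mass w h j)" by simp
  next
    assume "cylinder_mass w h i = (\<Sum>j\<in>succs i. cylinder_mass w h j)"
    then show "((\<lambda>j. Q_matrix E r w i j * h j) has_sum 0) UNIV"
      using Q_matrix_sum[of w i h] by (simp only: diff_self)
  qed
  then show ?thesis by (simp add: harmonic_def)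
qed

text \<open>By \<open>U_boundary_rec\<close> the kernel at a fixed site is, on rays, the constant
  \<open>w 0\<close> plus finitely many multiples of indicators of cylinders. Integrability
  therefore propagates from the root by induction, and integrating the recursion recovers the mass
  of each cylinder from an increment of the integral.\<close>

lemma integral_U_boundary:
  assumes "finite_measure \<nu>" and sets: "sets \<nu> = sets (boundary_borel E r)"
  shows "integrable \<nu> (U_boundary E r w i)"
    and "(\<integral>\<xi>. U_boundary E r w r \<xi> \<partial>\<nu>) = w 0 * measure \<nu> (cyl r)"
    and "i \<noteq> r \<Longrightarrow> (\<integral>\<xi>. U_boundary E r w i \<xi> \<partial>\<nu>) =
      (\<integral>\<xi>. U_boundary E r w (par i) \<xi> \<partial>\<nu>) + weight_incr w (lev i) * measure \<nu> (cyl i)"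
proof -
  interpret finite_measure \<nu> by fact
  have space: "space \<nu> = boundary E r"
    using sets_eq_imp_space_eq[OF sets] by (simp add: space_boundary_borel)
  have cyl: "cyl i \<in> sets \<nu>" for i by (simp add: sets cylinder_in_sets)
  have cyl_space: "cyl i \<inter> boundary E r = cyl i" for i by (auto simp: boundary_cylinder_def)
  \<comment> \<open>The formulas for the kernel are known for rays only, so they are substituted on
    the space of the measure.\<close>
  have root: "integrable \<nu> (U_boundary E r w r)"
    by (subst Bochner_Integration.integrable_cong[OF refl, where g = "\<lambda>_. w 0"]) (auto simp: U_boundary_root space)
  show "(\<integral>\<xi>. U_boundary E r w r \<xi> \<partial>\<nu>) = w 0 * measure \<nu> (cyl r)"
    by (subst Bochner_Integration.integral_cong[OF refl, where g = "\<lambda>_. w 0"])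
      (auto simp: U_boundary_root space)
  have step: "integrable \<nu> (U_boundary E r w i)"
    and eq: "(\<integral>\<xi>. U_boundary E r w i \<xi> \<partial>\<nu>) =
      (\<integral>\<xi>. U_boundary E r w (par i) \<xi> \<partial>\<nu>) + weight_incr w (lev i) * measure \<nu> (cyl i)"
    if "i \<noteq> r" "integrable \<nu> (U_boundary E r w (par i))" for i
  proof -
    let ?g = "\<lambda>\<xi>. U_boundary E r w (par i) \<xi> + weight_incr w (lev i) * indicator (cyl i) \<xi>"
    have ind: "integrable \<nu> (\<lambda>\<xi>. weight_incr w (lev i) * indicator (cyl i) \<xi>)"
      using cyl by (intro integrable_mult_right integrable_real_indicator)
        (auto simp: emeasure_finite less_top[symmetric])
    show "integrable \<nu> (U_boundary E r w i)"
      by (subst Bochner_Integration.integrable_cong[OF refl, where g = ?g])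
        (auto simp: U_boundary_rec that space intro!: Bochner_Integration.integrable_add ind)
    show "(\<integral>\<xi>. U_boundary E r w i \<xi> \<partial>\<nu>) =
        (\<integral>\<xi>. U_boundary E r w (par i) \<xi> \<partial>\<nu>) + weight_incr w (lev i) * measure \<nu> (cyl i)"
      using cyl that ind
      by (subst Bochner_Integration.integral_cong[OF refl, where g = ?g])
        (auto simp: U_boundary_rec space cyl_space)
  qed
  show int: "integrable \<nu> (U_boundary E r w i)" for i
    by (induction i rule: tree_induct) (auto intro: root step)
  show "i \<noteq> r \<Longrightarrow> (\<integral>\<xi>. U_boundary E r w i \<xi> \<partial>\<nu>) =
      (\<integral>\<xi>. U_boundary E r w (par i) \<xi> \<partial>\<nu>) + weight_incr w (lev i) * measure \<nu> (cyl i)"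
    using eq[OF _ int] .
qed

end

section \<open>The integral representation\<close>

lemma (in level_weights) weight_incr_pos: "0 < weight_incr w n"
  using weight_pos strict_monoD[OF weight_strict_mono, of "n - 1" n]
  by (auto simp: weight_incr_def)

theorem theorem3p1:
  fixes E :: "'i \<Rightarrow> 'i \<Rightarrow> bool" and r :: 'i and w :: "nat \<Rightarrow> real" and h :: "'i \<Rightarrow> real"
  assumes "infinite_rooted_tree E r"
    and "level_weights w"
    and "transient_tree_matrix E r w"
    and "\<And>i. 0 \<le> h i"
  shows "(harmonic (Q_matrix E r w) h \<and> tree_increasing E r h) \<longleftrightarrow>
    (\<exists>\<nu>. finite_measure \<nu> \<and> sets \<nu> = sets (boundary_borel E r) \<and>
      (\<forall>i. h i = (\<integral>\<xi>. U_boundary E r w i \<xi> \<partial>\<nu>)))"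
proof -
  interpret infinite_rooted_tree E r by fact
  interpret level_weights w by fact
  let ?m = "cylinder_mass w h"
  have increasing: "tree_increasing E r h \<longleftrightarrow> (\<forall>i. 0 \<le> ?m i)"
  proof -
    \<comment> \<open>At the root the mass is \<open>h r / w 0\<close>, nonnegative because
      \<open>h\<close> is.\<close>
    have "0 \<le> ?m i \<longleftrightarrow> i = r \<or> h (par i) \<le> h i" for i
      using assms(4)[of r] weight_incr_pos[of "lev i"]
      by (auto simp: cylinder_mass_def zero_le_divide_iff)
    then show ?thesis by (auto simp: tree_increasing_iff)
  qed
  have h_root: "h r = w 0 * ?m r"
    using weight_pos[of 0] by (simp add: cylinder_mass_def weight_incr_def)
  have h_rec: "h i = h (par i) + weight_incr w (lev i) * ?m i" if "i \<noteq> r" for i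
    using that weight_incr_pos[of "lev i"] by (simp add: cylinder_mass_def)
  \<comment> \<open>\<open>h\<close> and the integral satisfy the same kind of recursion from the
    root, one with \<open>?m\<close> and the other with the cylinder masses of the measure. Since
    the weight increments are positive, equal functions give equal masses; the converse is an
    induction along the tree.\<close>
  have potential: "(\<forall>i. h i = (\<integral>\<xi>. U_boundary E r w i \<xi> \<partial>\<nu>)) \<longleftrightarrow> (\<forall>i. measure \<nu> (cyl i) = ?m i)"
    if \<nu>: "finite_measure \<nu>" "sets \<nu> = sets (boundary_borel E r)" for \<nu>
  proof
    assume h: "\<forall>i. h i = (\<integral>\<xi>. U_boundary E r w i \<xi> \<partial>\<nu>)"
    show "\<forall>i. measure \<nu> (cyl i) = ?m i"
    proof
      fix i
      show "measure \<nu> (cyl i) = ?m i"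
      proof (cases "i = r")
        case True
        then show ?thesis
          using h integral_U_boundary(2)[OF \<nu>, of w] h_root weight_pos[of 0]
            by (auto simp del: cylinder_root)
      next
        case False
        then have "weight_incr w (lev i) * measure \<nu> (cyl i) = weight_incr w (lev i) * ?m i"
          using h integral_U_boundary(3)[OF \<nu> False, of w] h_rec[OF False] by simp
        then show ?thesis using weight_incr_pos[of "lev i"] by simp
      qed
    qed
  next
    assume m: "\<forall>i. measure \<nu> (cyl i) = ?m i"
    have "h i = (\<integral>\<xi>. U_boundary E r w i \<xi> \<partial>\<nu>)" for i
    proof (induction i rule: tree_induct)
      case root
      show ?case using integral_U_boundary(2)[OF \<nu>, of w] h_root m by (simp del: cylinder_root)
    next
      case (child i)
      then show ?case using integral_U_boundary(3)[OF \<nu>] h_rec m by simp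
    qed
    then show "\<forall>i. h i = (\<integral>\<xi>. U_boundary E r w i \<xi> \<partial>\<nu>)" by blast
  qed
  show ?thesis
  proof
    assume "harmonic (Q_matrix E r w) h \<and> tree_increasing E r h"
    then have "0 \<le> ?m i" "?m i = (\<Sum>j\<in>succs i. ?m j)" for i
      unfolding increasing harmonic_iff by blast+
    from ex_measure_on_boundary[of ?m, OF this] obtain \<nu> where "finite_measure \<nu>" "sets \<nu> = sets (boundary_borel E r)"
      "\<forall>i. measure \<nu> (cyl i) = ?m i" by blast
    with potential show "\<exists>\<nu>. finite_measure \<nu> \<and> sets \<nu> = sets (boundary_borel E r) \<and>
      (\<forall>i. h i = (\<integral>\<xi>. U_boundary E r w i \<xi> \<partial>\<nu>))" by blast
  next
    assume "\<exists>\<nu>. finite_measure \<nu> \<and> sets \<nu> = sets (boundary_borel E r) \<and>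
      (\<forall>i. h i = (\<integral>\<xi>. U_boundary E r w i \<xi> \<partial>\<nu>))"
    then obtain \<nu> where \<nu>: "finite_measure \<nu>" "sets \<nu> = sets (boundary_borel E r)"
      and m: "measure \<nu> (cyl i) = ?m i" for i
      using potential by blast
    interpret finite_measure \<nu> by fact
    \<comment> \<open>Every ray through \<open>i\<close> leaves it by exactly one successor, so
      additivity of the measure is the harmonicity equation at \<open>i\<close>.\<close>
    have "measure \<nu> (cyl i) = (\<Sum>j\<in>succs i. measure \<nu> (cyl j))" for i
      by (subst cylinder_eq_Union_successors, rule finite_measure_finite_Union)
        (auto simp: \<nu>(2) cylinder_in_sets disjoint_family_cylinder_successors)
    moreover have "0 \<le> ?m i" for i using measure_nonneg[of \<nu> "cyl i"] m by simp
    ultimately show "harmonic (Q_matrix E r w) h \<and> tree_increasing E r h"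
      unfolding harmonic_iff increasing m by blast
  qed
qed

end
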